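(* Let $(f_n)_{n\in\mathbb{N}}$ be a sequence of real valued measurable functions on $[0,1)$. The following are equivalent: (i) $(f_n)$ is statistically Cauchy in measure. (ii) There exists $f\in L^0$ such that $(f_n)$ converges statistically in measure to $f$.
   Context: $\mathbb{N}$ is the set of positive integers. The measure space is $([0,1),\Sigma,\lambda)$, with $\Sigma$ the $\sigma$-algebra of Lebesgue measurable subsets of $[0,1)$ and $\lambda$ Lebesgue measure. $L^0=L^0([0,1))$ is the space of real valued measurable functions on $[0,1)$, where functions equal $\lambda$-a.e. are identified. Density: for $A\subseteq\mathbb{N}$, $d(A)=\lim_{n\to\infty}\frac{|\{k\in A: k\le n\}|}{n}$, if this limit exists. Writing $d(A)=c$ means that the limit exists and equals $c$. For a function $h$ on $[0,1)$, $[|h|\ge\varepsilon]=\{x\in[0,1):|h(x)|\ge\varepsilon\}$. A real sequence $(a_n)$ converges statistically to $a\in\mathbb{R}$ if for every $\varepsilon>0$, $d(\{n\in\mathbb{N}:|a_n-a|\ge\varepsilon\})=0$. $(f_n)$ converges statistically in measure to $f$ if for every $\varepsilon>0$ the real sequence $\big(\lambda([|f_n-f|\ge\varepsilon])\big)_n$ converges statistically to $0$. $(f_n)$ is statistically Cauchy in measure if for every $\varepsilon>0$ and every $\delta>0$ there exists $n_0\in\mathbb{N}$ such that $$d\big(\big\{n\in\mathbb{N}:\lambda([|f_n-f_{n_0}|\ge\varepsilon])\ge\delta\big\}\big)=0.$$ *)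

theory Defs
  imports "HOL-Analysis.Analysis"
begin

text \<open>
  Sequences are functions on \<^typ>\<open>nat\<close>, but the index set is the set of positive
  integers, so the value at index \<open>0\<close> is never used.
\<close>

definition has_nat_density :: "nat set \<Rightarrow> real \<Rightarrow> bool" where
  "has_nat_density A c \<longleftrightarrow> (\<lambda>n. real (card (A \<inter> {1..n})) / real n) \<longlonglongrightarrow> c"

definition stat_converges :: "(nat \<Rightarrow> real) \<Rightarrow> real \<Rightarrow> bool" where
  "stat_converges a l \<longleftrightarrow> (\<forall>\<epsilon>>0. has_nat_density {n. 1 \<le> n \<and> \<bar>a n - l\<bar> \<ge> \<epsilon>} 0)"

text \<open>
  The interval \<open>[0,1)\<close> with the Lebesgue measurable sets (not only the Borel sets)
  and Lebesgue measure.
\<close>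

abbreviation unit_lebesgue :: "real measure" where
  "unit_lebesgue \<equiv> lebesgue_on {0..<1}"

definition dev_measure :: "(real \<Rightarrow> real) \<Rightarrow> real \<Rightarrow> real" where
  "dev_measure h \<epsilon> = measure unit_lebesgue {x \<in> {0..<1}. \<bar>h x\<bar> \<ge> \<epsilon>}"

definition stat_converges_in_measure :: "(nat \<Rightarrow> real \<Rightarrow> real) \<Rightarrow> (real \<Rightarrow> real) \<Rightarrow> bool" where
  "stat_converges_in_measure f g \<longleftrightarrow>
    (\<forall>\<epsilon>>0. stat_converges (\<lambda>n. dev_measure (\<lambda>x. f n x - g x) \<epsilon>) 0)"

definition stat_Cauchy_in_measure :: "(nat \<Rightarrow> real \<Rightarrow> real) \<Rightarrow> bool" where
  "stat_Cauchy_in_measure f \<longleftrightarrow>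
    (\<forall>\<epsilon>>0. \<forall>\<delta>>0. \<exists>n0\<ge>1.
      has_nat_density {n. 1 \<le> n \<and> dev_measure (\<lambda>x. f n x - f n0 x) \<epsilon> \<ge> \<delta>} 0)"

end

theory Submission
  imports Defs
begin

text \<open>
  Both directions rest on two facts. Sets of density zero form a proper ideal on the positive
  integers, so finitely many exceptional sets of density zero always leave a common index outside
  of them (\<open>common_good_index\<close>). The deviations obey a triangle inequality that splits
  threshold and measure simultaneously (\<open>dev_measure_triangle\<close>).

  If \<open>f\<close> converges statistically in measure to \<open>g\<close>, any index at which \<open>f n\<close> is close to \<open>g\<close>
  can serve as the reference index in the Cauchy condition.

  Conversely, take reference indices \<open>m k\<close> for the tolerances \<open>(1/2)^k\<close>. Both \<open>f (m k)\<close> and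
  \<open>f (m (k + 1))\<close> are close to a common \<open>f n\<close>, hence to each other, and the errors are summable.
  So the sequence of reference functions is Cauchy in measure in the ordinary sense, at a summable
  rate, and by the Riesz--Fischer argument (\<open>summable_deviations_converge_in_measure\<close>) it
  converges in measure to some \<open>g\<close>. For a large \<open>k\<close> the function \<open>f (m k)\<close> is close to \<open>g\<close>,
  and \<open>f n\<close> is close to \<open>f (m k)\<close> for all \<open>n\<close> outside a set of density zero.
\<close>

section \<open>Sets of natural density zero\<close>

lemma has_nat_density_zero_subset:
  assumes "has_nat_density B 0" "A \<inter> {1..} \<subseteq> B"
  shows "has_nat_density A 0"
  unfolding has_nat_density_def
proof (rule tendsto_sandwich[where f = "\<lambda>_. 0"])
  show "(\<lambda>n. real (card (B \<inter> {1..n})) / real n) \<longlonglongrightarrow> 0"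
    using assms(1) by (simp add: has_nat_density_def)
  have "card (A \<inter> {1..n}) \<le> card (B \<inter> {1..n})" for n
    using assms(2) by (intro card_mono) auto
  then show "\<forall>\<^sub>F n in sequentially.
      real (card (A \<inter> {1..n})) / real n \<le> real (card (B \<inter> {1..n})) / real n"
    by (intro always_eventually allI divide_right_mono) auto
qed auto

lemma has_nat_density_zero_Un:
  assumes "has_nat_density A 0" "has_nat_density B 0"
  shows "has_nat_density (A \<union> B) 0"
  unfolding has_nat_density_def
proof (rule tendsto_sandwich[where f = "\<lambda>_. 0"])
  show "(\<lambda>n. real (card (A \<inter> {1..n})) / real n + real (card (B \<inter> {1..n})) / real n)
      \<longlonglongrightarrow> 0"
    using tendsto_add[of _ 0 _ _ 0] assms unfolding has_nat_density_def by auto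
  have "card ((A \<union> B) \<inter> {1..n}) \<le> card (A \<inter> {1..n}) + card (B \<inter> {1..n})" for n
    by (metis Int_Un_distrib2 card_Un_le)
  then have "real (card ((A \<union> B) \<inter> {1..n})) / real n
      \<le> (real (card (A \<inter> {1..n})) + real (card (B \<inter> {1..n}))) / real n" for n
    by (intro divide_right_mono) (auto simp flip: of_nat_add)
  then show "\<forall>\<^sub>F n in sequentially. real (card ((A \<union> B) \<inter> {1..n})) / real n
      \<le> real (card (A \<inter> {1..n})) / real n + real (card (B \<inter> {1..n})) / real n"
    by (simp add: add_divide_distrib)
qed auto

text \<open>The ideal is proper: the set of all positive integers has density one.\<close>

lemma density_zero_misses_positive:
  assumes "has_nat_density A 0"
  obtains n where "1 \<le> n" "n \<notin> A"
proof -
  have False if "{1..} \<subseteq> A"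
  proof -
    have "A \<inter> {1..n} = {1..n}" for n
      using that by auto
    then have "(\<lambda>n. real n / real n) \<longlonglongrightarrow> 0"
      using assms by (simp add: has_nat_density_def)
    moreover have "(\<lambda>n. real n / real n) \<longlonglongrightarrow> 1"
      by (rule tendsto_eventually) (auto intro: eventually_sequentiallyI[of 1])
    ultimately show False
      using LIMSEQ_unique zero_neq_one by blast
  qed
  then show thesis
    using that by fastforce
qed

lemma common_good_index:
  assumes "has_nat_density {n. 1 \<le> n \<and> P n} 0" "has_nat_density {n. 1 \<le> n \<and> Q n} 0"
  obtains n where "1 \<le> n" "\<not> P n" "\<not> Q n"
  using density_zero_misses_positive[OF has_nat_density_zero_Un[OF assms]] by auto

section \<open>Deviations\<close>

lemma finite_measure_unit_lebesgue: "finite_measure unit_lebesgue"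
  by (rule finite_measureI) (simp add: emeasure_restrict_space space_restrict_space)

lemma dev_measure_nonneg: "0 \<le> dev_measure h \<epsilon>"
  by (simp add: dev_measure_def)

lemma dev_measure_swap: "dev_measure (\<lambda>x. u x - v x) \<epsilon> = dev_measure (\<lambda>x. v x - u x) \<epsilon>"
  by (simp add: dev_measure_def abs_minus_commute)

text \<open>
  A deviation of at least \<open>a + b\<close> between \<open>u\<close> and \<open>w\<close> forces one of at least \<open>a\<close> between
  \<open>u\<close> and \<open>v\<close> or one of at least \<open>b\<close> between \<open>v\<close> and \<open>w\<close>. This makes up for the failure of
  a triangle inequality at a single threshold.
\<close>

lemma dev_measure_triangle:
  assumes [measurable]: "u \<in> borel_measurable unit_lebesgue" "v \<in> borel_measurable unit_lebesgue"
    "w \<in> borel_measurable unit_lebesgue"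
    and "a + b \<le> c"
  shows "dev_measure (\<lambda>x. u x - w x) c
    \<le> dev_measure (\<lambda>x. u x - v x) a + dev_measure (\<lambda>x. v x - w x) b"
proof -
  interpret finite_measure unit_lebesgue
    by (rule finite_measure_unit_lebesgue)
  define D where "D h \<epsilon> = {x \<in> space unit_lebesgue. \<epsilon> \<le> \<bar>h x\<bar>}" for h :: "real \<Rightarrow> real" and \<epsilon>
  have D: "dev_measure h \<epsilon> = measure unit_lebesgue (D h \<epsilon>)" for h \<epsilon>
    by (simp add: dev_measure_def D_def space_restrict_space)
  have [measurable]: "D (\<lambda>x. u x - v x) a \<in> sets unit_lebesgue"
    "D (\<lambda>x. v x - w x) b \<in> sets unit_lebesgue"
    unfolding D_def by measurable
  have "D (\<lambda>x. u x - w x) c \<subseteq> D (\<lambda>x. u x - v x) a \<union> D (\<lambda>x. v x - w x) b"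
    using assms(4) unfolding D_def by auto
  then have "measure unit_lebesgue (D (\<lambda>x. u x - w x) c)
      \<le> measure unit_lebesgue (D (\<lambda>x. u x - v x) a \<union> D (\<lambda>x. v x - w x) b)"
    by (intro finite_measure_mono) auto
  also have "\<dots> \<le> measure unit_lebesgue (D (\<lambda>x. u x - v x) a)
      + measure unit_lebesgue (D (\<lambda>x. v x - w x) b)"
    by (intro measure_Un_le) auto
  finally show ?thesis
    by (simp add: D)
qed

text \<open>
  Deviations are non-negative, so their statistical convergence to zero needs no absolute value.
  In this form, convergence and the Cauchy condition carry the same pair of tolerances.
\<close>

lemma stat_converges_in_measure_iff:
  "stat_converges_in_measure f g \<longleftrightarrow>
    (\<forall>\<epsilon>>0. \<forall>\<delta>>0. has_nat_density {n. 1 \<le> n \<and> dev_measure (\<lambda>x. f n x - g x) \<epsilon> \<ge> \<delta>} 0)"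
  by (simp add: stat_converges_in_measure_def stat_converges_def dev_measure_nonneg)

section \<open>Completeness for summable deviations\<close>

text \<open>
  By the Borel--Cantelli lemma, almost every point eventually satisfies
  \<open>\<bar>h (k + 1) x - h k x\<bar> < r k\<close>, so the increments there are absolutely summable and \<open>h k x\<close>
  converges. On a finite measure space almost everywhere convergence implies convergence in
  measure.
\<close>

lemma (in finite_measure) summable_deviations_converge_in_measure:
  fixes h :: "nat \<Rightarrow> 'a \<Rightarrow> real"
  assumes h [measurable]: "\<And>k. h k \<in> borel_measurable M"
    and dev: "\<And>k. measure M {x \<in> space M. r k \<le> \<bar>h (Suc k) x - h k x\<bar>} \<le> r k"
    and r: "summable r"
  shows "\<exists>g \<in> borel_measurable M. \<forall>\<epsilon>>0.
    (\<lambda>k. measure M {x \<in> space M. \<epsilon> \<le> \<bar>h k x - g x\<bar>}) \<longlonglongrightarrow> 0"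
proof (intro bexI allI impI)
  \<comment> \<open>On the null set where \<open>h k x\<close> diverges, \<open>lim\<close> returns an unspecified constant; this keeps
    \<open>?g\<close> measurable.\<close>
  let ?g = "\<lambda>x. lim (\<lambda>k. h k x)"
  show [measurable]: "?g \<in> borel_measurable M"
    by measurable
  define E where "E k = {x \<in> space M. r k \<le> \<bar>h (Suc k) x - h k x\<bar>}" for k
  have [measurable]: "E k \<in> sets M" for k
    unfolding E_def by measurable
  have "summable (\<lambda>k. measure M (E k))"
    using dev by (intro summable_comparison_test[OF _ r]) (auto simp: E_def)
  then have "AE x in M. \<forall>\<^sub>F k in sequentially. x \<in> space M - E k"
    by (intro borel_cantelli_AE1) (auto simp: emeasure_eq_measure)
  then have conv: "AE x in M. (\<lambda>k. h k x) \<longlonglongrightarrow> ?g x"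
  proof (eventually_elim)
    case (elim x)
    then have "\<forall>\<^sub>F k in sequentially. norm (h (Suc k) x - h k x) \<le> r k"
      by eventually_elim (auto simp: E_def)
    then have "summable (\<lambda>k. h (Suc k) x - h k x)"
      by (rule summable_comparison_test_ev[OF _ r])
    then obtain s where "(\<lambda>n. \<Sum>k<n. h (Suc k) x - h k x) \<longlonglongrightarrow> s"
      by (auto simp: summable_def sums_def)
    then have "(\<lambda>n. h n x - h 0 x) \<longlonglongrightarrow> s"
      unfolding sum_lessThan_telescope[of "\<lambda>k. h k x"] .
    from tendsto_add[OF this tendsto_const[of "h 0 x"]]
    have "(\<lambda>n. h n x) \<longlonglongrightarrow> s + h 0 x"
      by simp
    with limI[OF this] show ?case
      by simp
  qed
  fix \<epsilon> :: real assume "0 < \<epsilon>"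
  define B where "B k = {x \<in> space M. \<epsilon> \<le> \<bar>h k x - ?g x\<bar>}" for k
  have [measurable]: "B k \<in> sets M" for k
    unfolding B_def by measurable
  \<comment> \<open>The indicators of the sets \<open>B k\<close> are dominated by 1 and vanish eventually at almost every
    point.\<close>
  have "(\<lambda>k. integral\<^sup>L M (indicator (B k) :: _ \<Rightarrow> real)) \<longlonglongrightarrow> integral\<^sup>L M (\<lambda>x. 0 :: real)"
  proof (rule integral_dominated_convergence[where w = "\<lambda>x. 1"])
    show "AE x in M. (\<lambda>k. indicator (B k) x :: real) \<longlonglongrightarrow> 0"
      using conv
    proof eventually_elim
      case (elim x)
      then have "\<forall>\<^sub>F k in sequentially. dist (h k x) (?g x) < \<epsilon>"
        using \<open>0 < \<epsilon>\<close> by (rule tendstoD)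
      then show ?case
        by (intro tendsto_eventually, eventually_elim) (auto simp: B_def dist_real_def)
    qed
  qed (auto simp: indicator_def)
  then show "(\<lambda>k. measure M {x \<in> space M. \<epsilon> \<le> \<bar>h k x - ?g x\<bar>}) \<longlonglongrightarrow> 0"
    by (simp add: B_def)
qed

section \<open>Completeness of statistical convergence in measure\<close>

lemma stat_converges_imp_stat_Cauchy_in_measure:
  assumes f: "\<And>n. 1 \<le> n \<Longrightarrow> f n \<in> borel_measurable unit_lebesgue"
    and g: "g \<in> borel_measurable unit_lebesgue"
    and conv: "stat_converges_in_measure f g"
  shows "stat_Cauchy_in_measure f"
  unfolding stat_Cauchy_in_measure_def
proof (intro allI impI)
  fix \<epsilon> \<delta> :: real assume "0 < \<epsilon>" "0 < \<delta>"
  let ?far = "\<lambda>n. \<delta> / 2 \<le> dev_measure (\<lambda>x. f n x - g x) (\<epsilon> / 2)"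
  have zero: "has_nat_density {n. 1 \<le> n \<and> ?far n} 0"
    using conv half_gt_zero[OF \<open>0 < \<epsilon>\<close>] half_gt_zero[OF \<open>0 < \<delta>\<close>]
    unfolding stat_converges_in_measure_iff by blast
  obtain n0 where n0: "1 \<le> n0" "\<not> ?far n0"
    using density_zero_misses_positive[OF zero] by blast
  have "?far n" if "1 \<le> n" "\<delta> \<le> dev_measure (\<lambda>x. f n x - f n0 x) \<epsilon>" for n
    using dev_measure_triangle[OF f[OF that(1)] g f[OF n0(1)], of "\<epsilon> / 2" "\<epsilon> / 2" \<epsilon>] that n0
    by (simp add: dev_measure_swap[of g])
  then show "\<exists>n0\<ge>1. has_nat_density {n. 1 \<le> n \<and> \<delta> \<le> dev_measure (\<lambda>x. f n x - f n0 x) \<epsilon>} 0"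
    using n0(1) by (intro exI[of _ n0] conjI has_nat_density_zero_subset[OF zero]) auto
qed

lemma stat_Cauchy_imp_stat_converges_in_measure:
  assumes f: "\<And>n. 1 \<le> n \<Longrightarrow> f n \<in> borel_measurable unit_lebesgue"
    and Cauchy: "stat_Cauchy_in_measure f"
  shows "\<exists>g \<in> borel_measurable unit_lebesgue. stat_converges_in_measure f g"
proof -
  let ?far = "\<lambda>k m n. (1/2) ^ k \<le> dev_measure (\<lambda>x. f n x - f m x) ((1/2) ^ k)"
  have "\<forall>k. \<exists>m\<ge>1. has_nat_density {n. 1 \<le> n \<and> ?far k m n} 0"
    using Cauchy by (simp add: stat_Cauchy_in_measure_def)
  from choice[OF this] obtain m
    where m: "\<And>k. 1 \<le> m k" "\<And>k. has_nat_density {n. 1 \<le> n \<and> ?far k (m k) n} 0"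
    by blast
  have fm: "f (m k) \<in> borel_measurable unit_lebesgue" for k
    by (rule f[OF m(1)])
  \<comment> \<open>Consecutive reference functions are compared through a common \<open>f n\<close>; the tolerances
    \<open>(1/2)^(k + 1)\<close> and \<open>(1/2)^k\<close> add up to at most \<open>2 * (1/2)^k\<close>.\<close>
  have step: "dev_measure (\<lambda>x. f (m (Suc k)) x - f (m k) x) (2 * (1/2) ^ k) \<le> 2 * (1/2) ^ k" for k
  proof -
    obtain n where n: "1 \<le> n" "\<not> ?far k (m k) n" "\<not> ?far (Suc k) (m (Suc k)) n"
      by (rule common_good_index[OF m(2)[of k] m(2)[of "Suc k"]])
    have "dev_measure (\<lambda>x. f (m (Suc k)) x - f (m k) x) (2 * (1/2) ^ k)
        \<le> dev_measure (\<lambda>x. f (m (Suc k)) x - f n x) ((1/2) ^ Suc k)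
          + dev_measure (\<lambda>x. f n x - f (m k) x) ((1/2) ^ k)"
      by (rule dev_measure_triangle[OF fm f[OF n(1)] fm]) simp
    also have "\<dots> \<le> (1/2) ^ Suc k + (1/2) ^ k"
      using n by (intro add_mono) (auto simp: dev_measure_swap[of "f (m (Suc k))"])
    also have "\<dots> \<le> 2 * (1/2) ^ k"
      by simp
    finally show ?thesis .
  qed
  interpret finite_measure unit_lebesgue
    by (rule finite_measure_unit_lebesgue)
  have "summable (\<lambda>k. 2 * (1/2 :: real) ^ k)"
    by (intro summable_mult summable_geometric) simp
  then obtain g where g: "g \<in> borel_measurable unit_lebesgue"
    and lim: "\<And>\<epsilon>. 0 < \<epsilon> \<Longrightarrow> (\<lambda>k. dev_measure (\<lambda>x. f (m k) x - g x) \<epsilon>) \<longlonglongrightarrow> 0"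
    using summable_deviations_converge_in_measure[of "\<lambda>k. f (m k)" "\<lambda>k. 2 * (1/2) ^ k"] fm step
    by (auto simp: dev_measure_def space_restrict_space)
  have "has_nat_density {n. 1 \<le> n \<and> \<delta> \<le> dev_measure (\<lambda>x. f n x - g x) \<epsilon>} 0"
    if "0 < \<epsilon>" "0 < \<delta>" for \<epsilon> \<delta>
  proof -
    \<comment> \<open>Both tolerances are split in half: one half for the distance of \<open>f (m k)\<close> from \<open>g\<close>,
      the other for that of \<open>f n\<close> from \<open>f (m k)\<close>.\<close>
    have "\<forall>\<^sub>F k in sequentially. dev_measure (\<lambda>x. f (m k) x - g x) (\<epsilon> / 2) < \<delta> / 2"
      by (rule order_tendstoD(2)[OF lim]) (use that in auto)
    moreover have "\<forall>\<^sub>F k in sequentially. (1/2 :: real) ^ k < min (\<epsilon> / 2) (\<delta> / 2)"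
      by (rule order_tendstoD(2)[OF LIMSEQ_realpow_zero]) (use that in auto)
    ultimately have "\<forall>\<^sub>F k in sequentially. dev_measure (\<lambda>x. f (m k) x - g x) (\<epsilon> / 2) < \<delta> / 2
        \<and> (1/2 :: real) ^ k < min (\<epsilon> / 2) (\<delta> / 2)"
      by (rule eventually_conj)
    then obtain k where k: "dev_measure (\<lambda>x. f (m k) x - g x) (\<epsilon> / 2) < \<delta> / 2"
        "(1/2 :: real) ^ k < \<epsilon> / 2" "(1/2 :: real) ^ k < \<delta> / 2"
      using eventually_happens'[OF sequentially_bot] by auto
    have "?far k (m k) n" if "1 \<le> n" "\<delta> \<le> dev_measure (\<lambda>x. f n x - g x) \<epsilon>" for n
      using dev_measure_triangle[OF f[OF that(1)] fm g, of "(1/2) ^ k" "\<epsilon> / 2" \<epsilon> k] that k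
      by simp
    then show ?thesis
      by (intro has_nat_density_zero_subset[OF m(2)[of k]]) auto
  qed
  with g show ?thesis
    by (auto simp: stat_converges_in_measure_iff)
qed

theorem theorem3p5:
  fixes f :: "nat \<Rightarrow> real \<Rightarrow> real"
  assumes "\<And>n. 1 \<le> n \<Longrightarrow> f n \<in> borel_measurable unit_lebesgue"
  shows "stat_Cauchy_in_measure f \<longleftrightarrow>
    (\<exists>g \<in> borel_measurable unit_lebesgue. stat_converges_in_measure f g)"
  using stat_converges_imp_stat_Cauchy_in_measure[of f, OF assms]
    stat_Cauchy_imp_stat_converges_in_measure[of f, OF assms] by blast

end
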